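(* Let $n$ be a nonnegative integer and let $x$ be a complex number. Then $$\sum_{k=0}^n\frac{\binom{n}{k}}{\binom{2k}{k}}2^{2k}(-1)^{k+1} x^k (1+x)^{n-k} = \sum_{k=0}^n\binom{n}{k}\frac{x^k}{2k-1} =\frac{2^{2n}}{\binom{2n}{n}}\sum_{k=0}^n\binom{2k}{k} 2^{-2k}\frac{(1+x)^{k}}{2k-1}.$$ In particular, $$\sum_{k=0}^n \frac{2^{2k}}{\binom{2k}{k}} = \frac{1}{3} \left(1+\frac{2^{2n+1}}{C_n} \right)$$ and, for $n\ge 1$, $$\sum_{k=1}^n C_k \frac{2^{-2k}}{2k-1} = \frac{1}{3}\left( 1 - 2^{-2n} C_n \right).$$
   Context: $C_n=\frac{1}{n+1}\binom{2n}{n}$ denotes the $n$th Catalan number. The convention $0^0=1$ is used for zeroth powers. *)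

theory Defs
  imports Complex_Main
begin

definition catalan :: "nat \<Rightarrow> real" where
  "catalan n = 1 / (real n + 1) * real ((2 * n) choose n)"

end

theory Submission
  imports Defs
begin

text \<open>
  Everything hinges on the numbers \<open>a n = 4 ^ n / (2 n choose n)\<close> (\<open>central_ratio\<close>),
  whose consecutive quotients are \<open>2 (n + 1) / (2 n + 1)\<close>.  Write \<open>M n x\<close> for the middle sum
  (\<open>reciprocal_odd_sum\<close>), which is formally the integral
  of \<open>(1 + x t\<^sup>2) ^ n / t\<^sup>2\<close> up to \<open>t = 1\<close>.  Integration by parts suggests the recurrence
  \<open>(2 n + 1) M (n + 1) x = 2 (n + 1) M n x + (1 + x) ^ (n + 1)\<close>, which is proved by comparing
  coefficients (\<open>reciprocal_odd_sum_Suc\<close>).  Its homogeneous part is solved by \<open>a\<close>, so dividing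
  by \<open>(2 n + 1) a (n + 1)\<close> turns it into a telescoping sum, which is the right-hand side.

  At \<open>x = - 1\<close> the right-hand side collapses to its first term, so that the binomial transform of
  \<open>(- 1) ^ k / (2 k - 1)\<close> is \<open>- a n\<close>.  Binomial inversion exhibits \<open>1 / (2 n - 1)\<close> as the
  binomial transform of \<open>(- 1) ^ (k + 1) a k\<close>, and inserting this expression into the middle sum
  and exchanging the summations (\<open>sum_binomial_transform\<close>) gives the left-hand side.

  The two closed forms telescope as well: \<open>2 (n + 1) a n\<close> has increments \<open>3 a (n + 1)\<close>, and
  \<open>C\<^sub>n / 4 ^ n = 1 / ((n + 1) a n)\<close> has increments proportional to the summand in question.
\<close>

section \<open>The normalised reciprocal central binomial coefficients\<close>

definition central_ratio :: "nat \<Rightarrow> 'a::field_char_0" where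
  "central_ratio n = 4 ^ n / of_nat ((2 * n) choose n)"

lemma central_ratio_0 [simp]: "central_ratio 0 = 1"
  by (simp add: central_ratio_def)

lemma central_ratio_nonzero [simp]: "central_ratio n \<noteq> 0"
  by (simp add: central_ratio_def)

lemma Suc_times_central_binomial:
  "Suc n * ((2 * Suc n) choose Suc n) = 2 * (2 * n + 1) * ((2 * n) choose n)"
proof -
  have "Suc n * ((2 * Suc n) choose Suc n) = 2 * (Suc n * (Suc (2 * n) choose n))"
    using Suc_times_binomial_eq[of "Suc (2 * n)" n]
    by (simp add: algebra_simps del: binomial_Suc_Suc)
  also have "Suc (2 * n) choose n = Suc (2 * n) choose Suc n"
    using binomial_symmetric[of n "Suc (2 * n)"] by simp
  also have "Suc n * (Suc (2 * n) choose Suc n) = (2 * n + 1) * ((2 * n) choose n)"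
    using Suc_times_binomial_eq[of "2 * n" n] by (simp only: mult.commute Suc_eq_plus1)
  finally show ?thesis by simp
qed

lemma odd_of_nat_nonzero:
  "2 * of_nat n + 1 \<noteq> (0::'a::field_char_0)" "2 * of_nat n - 1 \<noteq> (0::'a)"
proof -
  have "of_nat (2 * n + 1) \<noteq> (0::'a)"
    by (simp only: of_nat_eq_0_iff)
  then show "2 * of_nat n + 1 \<noteq> (0::'a)" by (simp add: add.commute)
  have "of_nat (2 * n) \<noteq> (of_nat 1::'a)"
    by (simp only: of_nat_eq_iff) presburger
  then show "2 * of_nat n - 1 \<noteq> (0::'a)" by simp
qed

lemma central_ratio_Suc:
  "(2 * of_nat n + 1) * central_ratio (Suc n) = 2 * of_nat (Suc n) * (central_ratio n :: 'a::field_char_0)"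
proof -
  have "of_nat (Suc n) * of_nat ((2 * Suc n) choose Suc n)
      = (2 * (2 * of_nat n + 1) * of_nat ((2 * n) choose n) :: 'a)"
    using arg_cong[OF Suc_times_central_binomial[of n], of "of_nat :: nat \<Rightarrow> 'a"]
    by (simp only: of_nat_mult of_nat_add of_nat_numeral of_nat_1)
  moreover have "of_nat ((2 * Suc n) choose Suc n) \<noteq> (0::'a)" "of_nat ((2 * n) choose n) \<noteq> (0::'a)"
    by (simp_all del: binomial_Suc_Suc)
  moreover have "m * (4 * q / d) = 2 * l * (q / c)"
    if "l * d = 2 * m * c" "d \<noteq> 0" "c \<noteq> 0" for l m c d q :: 'a
    using that by (simp add: divide_simps)
  ultimately show ?thesis
    unfolding central_ratio_def power_Suc by blast
qed

section \<open>Binomial transforms\<close>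

text \<open>
  Expanding \<open>(1 + x) ^ (n - k)\<close> and collecting powers of \<open>x\<close> reduces this to the subset-of-a-subset
  identity \<open>(n choose j) (j choose k) = (n choose k) (n - k choose j - k)\<close>.
\<close>
lemma sum_binomial_transform:
  fixes x :: "'a::comm_ring_1"
  shows "(\<Sum>j\<le>n. of_nat (n choose j) * x ^ j * (\<Sum>k\<le>j. of_nat (j choose k) * b k))
       = (\<Sum>k\<le>n. of_nat (n choose k) * b k * x ^ k * (1 + x) ^ (n - k))"
proof -
  have inner: "(\<Sum>j=k..n. of_nat (n choose j) * x ^ j * (of_nat (j choose k) * b k))
      = of_nat (n choose k) * b k * x ^ k * (1 + x) ^ (n - k)" if "k \<le> n" for k
  proof -
    have "(\<Sum>j=k..n. of_nat (n choose j) * x ^ j * (of_nat (j choose k) * b k))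
        = (\<Sum>i\<le>n - k. of_nat (n choose (i + k)) * x ^ (i + k) * (of_nat ((i + k) choose k) * b k))"
      using sum.shift_bounds_cl_nat_ivl[of "\<lambda>j. of_nat (n choose j) * x ^ j * (of_nat (j choose k) * b k)"
          0 k "n - k"] that
      by (simp add: atLeast0AtMost)
    also have "\<dots> = (\<Sum>i\<le>n - k. of_nat (n choose k) * b k * x ^ k * (of_nat ((n - k) choose i) * x ^ i))"
    proof (rule sum.cong[OF refl])
      fix i assume "i \<in> {..n - k}"
      then have "of_nat (n choose (i + k)) * of_nat ((i + k) choose k)
          = (of_nat (n choose k) * of_nat ((n - k) choose i) :: 'a)"
        using choose_mult[of k "i + k" n] that by (simp flip: of_nat_mult)
      then show "of_nat (n choose (i + k)) * x ^ (i + k) * (of_nat ((i + k) choose k) * b k)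
          = of_nat (n choose k) * b k * x ^ k * (of_nat ((n - k) choose i) * x ^ i)"
        by (simp add: power_add algebra_simps)
    qed
    also have "\<dots> = of_nat (n choose k) * b k * x ^ k * (1 + x) ^ (n - k)"
      using binomial_ring[of x 1 "n - k"] by (simp add: sum_distrib_left add.commute)
    finally show ?thesis .
  qed
  have "(\<Sum>j\<le>n. of_nat (n choose j) * x ^ j * (\<Sum>k\<le>j. of_nat (j choose k) * b k))
      = (\<Sum>j\<le>n. \<Sum>k\<le>j. of_nat (n choose j) * x ^ j * (of_nat (j choose k) * b k))"
    by (simp add: sum_distrib_left)
  also have "\<dots> = (\<Sum>k\<le>n. \<Sum>j=k..n. of_nat (n choose j) * x ^ j * (of_nat (j choose k) * b k))"
    using sum.swap_restrict[of "{..n}" "{..n}"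
        "\<lambda>j k. of_nat (n choose j) * x ^ j * (of_nat (j choose k) * b k)" "\<lambda>j k. k \<le> j"]
    by (simp add: atMost_def atLeastAtMost_def Int_def conj_commute cong: conj_cong)
  also have "\<dots> = (\<Sum>k\<le>n. of_nat (n choose k) * b k * x ^ k * (1 + x) ^ (n - k))"
    by (rule sum.cong) (simp_all add: inner)
  finally show ?thesis .
qed

text \<open>At \<open>x = - 1\<close> the factor \<open>(1 + x) ^ (n - k)\<close> annihilates every term but the last.\<close>
lemma binomial_inversion:
  fixes b :: "nat \<Rightarrow> 'a::comm_ring_1"
  shows "(\<Sum>j\<le>n. of_nat (n choose j) * (- 1) ^ j * (\<Sum>k\<le>j. of_nat (j choose k) * b k)) = (- 1) ^ n * b n"
proof -
  have "(\<Sum>k\<le>n. of_nat (n choose k) * b k * (- 1) ^ k * (1 + - 1) ^ (n - k))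
      = (\<Sum>k\<le>n. if k = n then (- 1) ^ n * b n else 0)"
    by (rule sum.cong) (auto simp: power_0_left)
  then show ?thesis
    unfolding sum_binomial_transform by simp
qed

section \<open>The polynomials with reciprocal odd weights\<close>

definition reciprocal_odd_sum :: "nat \<Rightarrow> 'a::field_char_0 \<Rightarrow> 'a" where
  "reciprocal_odd_sum n x = (\<Sum>k\<le>n. of_nat (n choose k) * (x ^ k / (2 * of_nat k - 1)))"

text \<open>
  By Pascal's rule the difference of the sums for \<open>n + 1\<close> and \<open>n\<close> has the coefficients
  \<open>n choose (k - 1)\<close>.  Absorption turns \<open>2 (n + 1)\<close> times these into
  \<open>2 k ((n + 1) choose k)\<close>, and \<open>2 k / (2 k - 1) = 1 + 1 / (2 k - 1)\<close> splits off a binomial expansion.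
\<close>
lemma reciprocal_odd_sum_Suc:
  fixes x :: "'a::field_char_0"
  shows "(2 * of_nat n + 1) * reciprocal_odd_sum (Suc n) x
     = 2 * of_nat (Suc n) * reciprocal_odd_sum n x + (1 + x) ^ Suc n"
proof -
  have extend: "reciprocal_odd_sum n x = (\<Sum>k\<le>Suc n. of_nat (n choose k) * (x ^ k / (2 * of_nat k - 1)))"
    by (simp add: reciprocal_odd_sum_def)
  have binom: "(1 + x) ^ Suc n = (\<Sum>k\<le>Suc n. of_nat (Suc n choose k) * x ^ k)"
    using binomial_ring[of x 1 "Suc n"] by (simp add: add.commute del: power_Suc sum.atMost_Suc)
  have coeff: "(2 * of_nat n + 1) * (of_nat (Suc n choose k) * (x ^ k / (2 * of_nat k - 1)))
      = 2 * of_nat (Suc n) * (of_nat (n choose k) * (x ^ k / (2 * of_nat k - 1)))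
        + of_nat (Suc n choose k) * x ^ k" if "k \<le> Suc n" for k
  proof -
    have "Suc n * (Suc n choose k) = Suc n * (n choose k) + k * (Suc n choose k)"
      by (cases k) (use Suc_times_binomial_eq[of n] in \<open>auto simp: algebra_simps\<close>)
    then have "of_nat (Suc n * (Suc n choose k)) = (of_nat (Suc n * (n choose k) + k * (Suc n choose k)) :: 'a)"
      by (rule arg_cong)
    then have "(of_nat n + 1) * of_nat (Suc n choose k)
        = ((of_nat n + 1) * of_nat (n choose k) + of_nat k * of_nat (Suc n choose k) :: 'a)"
      by (simp only: of_nat_mult of_nat_add of_nat_Suc add.commute)
    then have eq: "(2 * of_nat n + 1) * of_nat (Suc n choose k)
        = (2 * (of_nat n + 1) * of_nat (n choose k) + (2 * of_nat k - 1) * of_nat (Suc n choose k) :: 'a)"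
      by algebra
    obtain w where w_def: "w = x ^ k / (2 * of_nat k - 1)"
      by simp
    then have w: "x ^ k = (2 * of_nat k - 1) * w"
      using odd_of_nat_nonzero(2)[of k, where 'a='a] by simp
    show ?thesis
      unfolding w_def[symmetric] unfolding w of_nat_Suc[of n] using eq by algebra
  qed
  show ?thesis
    unfolding extend binom reciprocal_odd_sum_def[of "Suc n"] sum_distrib_left sum.distrib[symmetric]
    by (rule sum.cong) (simp_all only: coeff atMost_iff)
qed

lemma reciprocal_odd_sum_eq_central:
  fixes x :: "'a::field_char_0"
  shows "reciprocal_odd_sum n x
     = central_ratio n * (\<Sum>k\<le>n. (1 + x) ^ k / (central_ratio k * (2 * of_nat k - 1)))"
proof (induction n)
  case 0
  show ?case by (simp add: reciprocal_odd_sum_def)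
next
  case (Suc n)
  let ?d = "2 * of_nat n + 1 :: 'a"
  let ?S = "\<Sum>k\<le>n. (1 + x) ^ k / (central_ratio k * (2 * of_nat k - 1))"
  have d: "2 * of_nat (Suc n) - 1 = ?d" by simp
  have "?d * reciprocal_odd_sum (Suc n) x = ?d * central_ratio (Suc n) * ?S + (1 + x) ^ Suc n"
    unfolding reciprocal_odd_sum_Suc Suc.IH central_ratio_Suc by (simp add: mult.assoc)
  also have "\<dots> = ?d * (central_ratio (Suc n) * (?S + (1 + x) ^ Suc n / (central_ratio (Suc n) * ?d)))"
    using odd_of_nat_nonzero(1)[of n, where 'a='a]
    by (simp add: distrib_left[of _ ?S] distrib_left[of _ "central_ratio (Suc n) * ?S"] mult.assoc
        del: power_Suc)
  finally show ?case
    unfolding sum.atMost_Suc d using odd_of_nat_nonzero(1)[of n, where 'a='a] by simp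
qed

lemma reciprocal_odd_sum_minus_one:
  "reciprocal_odd_sum n (- 1) = - (central_ratio n :: 'a::field_char_0)"
proof -
  have "(\<Sum>k\<le>n. (1 + - 1 :: 'a) ^ k / (central_ratio k * (2 * of_nat k - 1)))
      = (\<Sum>k\<le>n. if k = 0 then - 1 else 0)"
    by (rule sum.cong) auto
  then show ?thesis
    unfolding reciprocal_odd_sum_eq_central by simp
qed

text \<open>This is the inversion of the value of the polynomials at \<open>- 1\<close>.\<close>
lemma binomial_transform_central_ratio:
  "(\<Sum>k\<le>n. of_nat (n choose k) * ((- 1) ^ (k + 1) * central_ratio k)) = 1 / (2 * of_nat n - 1 :: 'a::field_char_0)"
proof -
  let ?b = "\<lambda>k. (- 1) ^ k / (2 * of_nat k - 1) :: 'a"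
  have "(\<Sum>k\<le>n. of_nat (n choose k) * ((- 1) ^ (k + 1) * central_ratio k))
      = (\<Sum>j\<le>n. of_nat (n choose j) * (- 1) ^ j * reciprocal_odd_sum j (- 1 :: 'a))"
    by (simp add: reciprocal_odd_sum_minus_one mult.assoc)
  also have "\<dots> = (- 1) ^ n * ?b n"
    unfolding reciprocal_odd_sum_def by (rule binomial_inversion)
  also have "\<dots> = 1 / (2 * of_nat n - 1)"
    by (simp flip: power_mult_distrib)
  finally show ?thesis .
qed

lemma reciprocal_odd_sum_eq_mixed:
  "reciprocal_odd_sum n x
     = (\<Sum>k\<le>n. of_nat (n choose k) * ((- 1) ^ (k + 1) * central_ratio k) * x ^ k * (1 + x) ^ (n - k))"
  unfolding sum_binomial_transform[symmetric] binomial_transform_central_ratio reciprocal_odd_sum_def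
  by simp

section \<open>The closed forms\<close>

lemma sum_central_ratio:
  "(\<Sum>k\<le>n. central_ratio k) = (1 + 2 * of_nat (Suc n) * central_ratio n) / (3 :: 'a::field_char_0)"
proof (induction n)
  case 0
  show ?case by simp
next
  case (Suc n)
  have "3 * (\<Sum>k\<le>Suc n. central_ratio k)
      = 1 + (2 * of_nat n + 1) * central_ratio (Suc n) + 3 * (central_ratio (Suc n) :: 'a)"
    unfolding central_ratio_Suc by (simp add: Suc.IH)
  also have "\<dots> = 1 + 2 * of_nat (Suc (Suc n)) * central_ratio (Suc n)"
    by (simp add: algebra_simps)
  finally show ?case by (simp add: field_simps)
qed

lemma catalan_eq_central_ratio:
  "catalan n / 4 ^ n = 1 / (real (Suc n) * central_ratio n)"
  by (simp add: catalan_def central_ratio_def add.commute)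

text \<open>
  Put \<open>t k = C\<^sub>k / 4 ^ k\<close>.  The recurrence of \<open>central_ratio\<close> gives
  \<open>t k = 2 (k + 2) t (k + 1) / (2 k + 1)\<close>, so that \<open>(t k - t (k + 1)) / 3\<close>
  is \<open>t (k + 1) / (2 k + 1)\<close>, the summand with index \<open>k + 1\<close>.
\<close>
lemma sum_scaled_catalan:
  "(\<Sum>k=1..n. catalan k / 4 ^ k / (2 * real k - 1)) = (1 - catalan n / 4 ^ n) / 3"
proof (induction n)
  case 0
  show ?case by (simp add: catalan_def)
next
  case (Suc n)
  define t where "t = (\<lambda>k. catalan k / 4 ^ k)"
  have "t n * (2 * real n + 1) = 2 * (real n + 2) * t (Suc n)"
    using central_ratio_Suc[of n, where 'a=real]
    unfolding t_def catalan_eq_central_ratio by (simp add: divide_simps) algebra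
  then have "t (Suc n) / (2 * real n + 1) = (t n - t (Suc n)) / 3"
    by (simp add: divide_simps) algebra
  then show ?case
    using Suc.IH by (simp add: t_def add.commute diff_divide_distrib)
qed

section \<open>The combined statement\<close>

lemma two_power_even: "(2::'a::comm_semiring_1) ^ (2 * k) = 4 ^ k"
  by (simp add: power_mult)

lemma two_powi_neg_even: "(2::'a::field_char_0) powi (- 2 * int k) = 1 / 4 ^ k"
proof -
  have "(2::'a) powi (- 2 * int k) = inverse (2 powi int (2 * k))"
    by (simp flip: power_int_minus)
  then show ?thesis
    by (simp only: power_int_of_nat two_power_even inverse_eq_divide)
qed

theorem corollary3p7:
  fixes n :: nat and x :: complex
  shows "(\<Sum>k=0..n. of_nat (n choose k) / of_nat ((2 * k) choose k) * 2 ^ (2 * k) * (- 1) ^ (k + 1)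
              * x ^ k * (1 + x) ^ (n - k))
           = (\<Sum>k=0..n. of_nat (n choose k) * (x ^ k / (2 * of_nat k - 1)))
       \<and> (\<Sum>k=0..n. of_nat (n choose k) * (x ^ k / (2 * of_nat k - 1)))
           = 2 ^ (2 * n) / of_nat ((2 * n) choose n)
              * (\<Sum>k=0..n. of_nat ((2 * k) choose k) * 2 powi (- 2 * int k)
                    * ((1 + x) ^ k / (2 * of_nat k - 1)))
       \<and> (\<Sum>k=0..n. 2 ^ (2 * k) / real ((2 * k) choose k))
           = 1 / 3 * (1 + 2 ^ (2 * n + 1) / catalan n)
       \<and> (n \<ge> 1 \<longrightarrow>
           (\<Sum>k=1..n. catalan k * (2 powi (- 2 * int k) / (2 * real k - 1)))
             = 1 / 3 * (1 - 2 powi (- 2 * int n) * catalan n))"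
proof -
  have "(\<Sum>k=0..n. of_nat (n choose k) / of_nat ((2 * k) choose k) * 2 ^ (2 * k) * (- 1) ^ (k + 1)
          * x ^ k * (1 + x) ^ (n - k)) = reciprocal_odd_sum n x"
    unfolding reciprocal_odd_sum_eq_mixed central_ratio_def two_power_even
    by (simp add: atLeast0AtMost mult_ac)
  moreover have "(\<Sum>k=0..n. of_nat (n choose k) * (x ^ k / (2 * of_nat k - 1))) = reciprocal_odd_sum n x"
    by (simp add: reciprocal_odd_sum_def atLeast0AtMost)
  moreover have "2 ^ (2 * n) / of_nat ((2 * n) choose n)
      * (\<Sum>k=0..n. of_nat ((2 * k) choose k) * 2 powi (- 2 * int k) * ((1 + x) ^ k / (2 * of_nat k - 1)))
      = reciprocal_odd_sum n x"
    unfolding reciprocal_odd_sum_eq_central central_ratio_def two_power_even two_powi_neg_even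
    by (simp add: atLeast0AtMost mult_ac)
  moreover have "(\<Sum>k=0..n. 2 ^ (2 * k) / real ((2 * k) choose k)) = 1 / 3 * (1 + 2 ^ (2 * n + 1) / catalan n)"
  proof -
    have "2 ^ (2 * n + 1) / catalan n = 2 * real (Suc n) * central_ratio n"
      unfolding two_power_even power_add power_one_right
      by (simp add: central_ratio_def catalan_def algebra_simps)
    moreover have "(\<Sum>k=0..n. 2 ^ (2 * k) / real ((2 * k) choose k)) = (\<Sum>k\<le>n. central_ratio k)"
      unfolding two_power_even by (simp add: central_ratio_def atLeast0AtMost)
    ultimately show ?thesis
      unfolding sum_central_ratio by simp
  qed
  moreover have "(\<Sum>k=1..n. catalan k * (2 powi (- 2 * int k) / (2 * real k - 1)))
      = 1 / 3 * (1 - 2 powi (- 2 * int n) * catalan n)"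
    using sum_scaled_catalan[of n] unfolding two_powi_neg_even by simp
  ultimately show ?thesis by simp
qed

end
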